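(* Let $F$ be a field of characteristic not $2$ and let $R$ be a unital commutative associative $F$-algebra which is a unique factorization domain. If $H\in\mathfrak{sl}_2(R)$ satisfies $H^2=I$, where $I$ is the $2\times 2$ identity matrix, then there exist $X,Y\in\mathfrak{sl}_2(R)$ such that $(X,H,Y)$ is an $s\ell_2$-triple.
   Context: $\mathfrak{sl}_2(R)$ denotes the set of $2\times 2$ matrices $\begin{pmatrix}a&b\\c&-a\end{pmatrix}$ with $a,b,c\in R$, viewed as a Lie algebra over $F$ under the commutator bracket. A triple $(e,h,f)$ of nonzero elements of a Lie algebra is called an $s\ell_2$-triple if $[h,e]=2e$, $[h,f]=-2f$, $[e,f]=h$. The product $H^2$ is the matrix product in $M_2(R)$. *)

theory Defs
  imports "HOL-Analysis.Analysis" "HOL-Algebra.Algebraic_Closure_Type"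
begin

(* Over a commutative carrier, left compatibility of scaling with the product
   already gives bilinearity of the product. *)
locale commutative_algebra = vector_space smul
  for smul :: "'f::field \<Rightarrow> 'r::comm_ring_1 \<Rightarrow> 'r" +
  assumes smul_mult_left: "smul c x * y = smul c (x * y)"

locale lie_algebra = vector_space smul
  for smul :: "'f::field \<Rightarrow> 'v::ab_group_add \<Rightarrow> 'v" +
  fixes bracket :: "'v \<Rightarrow> 'v \<Rightarrow> 'v" and L :: "'v set"
  assumes subspace: "subspace L"
    and bracket_closed: "x \<in> L \<Longrightarrow> y \<in> L \<Longrightarrow> bracket x y \<in> L"
    and bracket_add_left:
      "x \<in> L \<Longrightarrow> y \<in> L \<Longrightarrow> z \<in> L \<Longrightarrow> bracket (x + y) z = bracket x z + bracket y z"
    and bracket_add_right: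
      "x \<in> L \<Longrightarrow> y \<in> L \<Longrightarrow> z \<in> L \<Longrightarrow> bracket x (y + z) = bracket x y + bracket x z"
    and bracket_smul_left:
      "x \<in> L \<Longrightarrow> y \<in> L \<Longrightarrow> bracket (smul c x) y = smul c (bracket x y)"
    and bracket_smul_right:
      "x \<in> L \<Longrightarrow> y \<in> L \<Longrightarrow> bracket x (smul c y) = smul c (bracket x y)"
    and bracket_self: "x \<in> L \<Longrightarrow> bracket x x = 0"
    and jacobi:
      "x \<in> L \<Longrightarrow> y \<in> L \<Longrightarrow> z \<in> L \<Longrightarrow>
        bracket x (bracket y z) + bracket y (bracket z x) + bracket z (bracket x y) = 0"

definition sl2_triple ::
  "('f::field \<Rightarrow> 'v::ab_group_add \<Rightarrow> 'v) \<Rightarrow> ('v \<Rightarrow> 'v \<Rightarrow> 'v) \<Rightarrow> 'v set \<Rightarrow> 'v \<Rightarrow> 'v \<Rightarrow> 'v \<Rightarrow> bool"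
  where "sl2_triple smul bracket L e h f \<longleftrightarrow>
    e \<in> L \<and> h \<in> L \<and> f \<in> L \<and> e \<noteq> 0 \<and> h \<noteq> 0 \<and> f \<noteq> 0 \<and>
    bracket h e = smul 2 e \<and> bracket h f = smul (- 2) f \<and> bracket e f = h"

definition sl2 :: "('r::comm_ring_1 ^ 2 ^ 2) set"
  where "sl2 = {vector [vector [a, b], vector [c, - a]] | a b c. True}"

definition commutator :: "'r::comm_ring_1 ^ 'n ^ 'n \<Rightarrow> 'r ^ 'n ^ 'n \<Rightarrow> 'r ^ 'n ^ 'n"
  where "commutator A B = A ** B - B ** A"

definition mat_smul :: "('f \<Rightarrow> 'r \<Rightarrow> 'r) \<Rightarrow> 'f \<Rightarrow> 'r ^ 'n ^ 'm \<Rightarrow> 'r ^ 'n ^ 'm"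
  where "mat_smul smul c A = (\<chi> i j. smul c (A $ i $ j))"

lemma sl2_iff: "A \<in> sl2 \<longleftrightarrow> A $ 2 $ 2 = - A $ 1 $ 1"
  by (auto simp: sl2_def vec_eq_iff forall_2 vector_2)

lemma (in commutative_algebra) lie_algebra_sl2:
  "lie_algebra (mat_smul smul) commutator (sl2 :: ('r ^ 2 ^ 2) set)"
proof -
  have r: "x * smul c y = smul c (x * y)" for c x y
    using smul_mult_left[of c y x] by (simp add: mult.commute)
  interpret M: vector_space "mat_smul smul :: 'f \<Rightarrow> 'r ^ 2 ^ 2 \<Rightarrow> 'r ^ 2 ^ 2"
    by unfold_locales
      (simp_all add: mat_smul_def vec_eq_iff scale_right_distrib scale_left_distrib)
  note e = mat_smul_def commutator_def matrix_matrix_mult_def vec_eq_iff forall_2 sum_2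
    smul_mult_left r sl2_iff
  show ?thesis
    by unfold_locales
      (auto simp: e M.subspace_def scale_right_distrib scale_right_diff_distrib algebra_simps)
qed

end

theory Submission
  imports Defs
begin

text \<open>
  As \<open>2\<close> is invertible and \<open>H\<^sup>2 = I\<close>, the matrix \<open>P = (I + H) / 2\<close> is the projection onto the
  eigenspace of \<open>H\<close> for the eigenvalue \<open>1\<close>. As \<open>H\<close> has trace zero, the entries \<open>p, q\<close> (upper row)
  and \<open>r, s\<close> (lower row) of \<open>P\<close> satisfy \<open>p + s = 1\<close>, and \<open>H\<^sup>2 = I\<close> gives \<open>p * s = q * r\<close>.
  Over a field this makes \<open>P\<close> the product of a column and a row. Over a general domain that fails,
  and it is exactly here that unique factorization enters: if \<open>p \<noteq> 0\<close>, then by distributing the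
  prime factors of \<open>p\<close> over \<open>q\<close> and \<open>r\<close> one gets \<open>p = x * y\<close>, \<open>q = x * z\<close>, \<open>r = w * y\<close> and
  \<open>s = w * z\<close> (lemmas \<open>four_number_prime_product\<close> and \<open>four_number\<close>).

  Now \<open>x * y + w * z = p + s = 1\<close>, so the matrix \<open>g\<close> with columns \<open>(x, w)\<close> and \<open>(- z, y)\<close> has
  determinant \<open>1\<close>; its columns are eigenvectors of \<open>H\<close> for \<open>1\<close> and \<open>- 1\<close>. Conjugating the standard
  triple of \<open>2 \<times> 2\<close> matrices by \<open>g\<close> gives one with \<open>H\<close> in the middle. Its outer members are nonzero
  because their bracket is \<open>H\<close>, whose square is \<open>I \<noteq> 0\<close>.
\<close>

text \<open>
  The passage from the carrier-based notion of factoriality to divisibility in the type. The primes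
  of the carrier are tested only on nonzero products, but every element divides \<open>0\<close>.
\<close>

lemma factorial_domain_prime_factors:
  fixes a :: "'r::comm_ring_1"
  assumes "factorial_domain (ring_of_type_algebra :: 'r ring)" and "a \<noteq> 0"
  obtains u ps where "u dvd 1" "\<forall>p\<in>set ps. prime_elem p" "a = u * prod_list ps"
proof -
  define R where "R = (ring_of_type_algebra :: 'r ring)"
  interpret factorial_domain R
    using assms(1) by (simp add: R_def)
  have R_simps: "carrier R = UNIV" "mult R = (*)" "monoid.one R = 1" "ring.zero R = 0"
    by (simp_all add: R_def ring_of_type_algebra_def)
  have units: "x \<in> Units R \<longleftrightarrow> x dvd 1" for x
    by (auto simp: Units_def R_simps dvd_def mult.commute)
  have divides: "factor (mult_of R) x y \<longleftrightarrow> x dvd y" if "y \<noteq> 0" for x y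
    using that by (auto simp: factor_def R_simps dvd_def)
  have prime: "prime_elem p" if "p \<noteq> 0" "Divisibility.irreducible (mult_of R) p" for p
  proof -
    have p: "Divisibility.prime (mult_of R) p"
      using irreducible_prime that by (simp add: R_simps)
    show ?thesis
    proof (rule prime_elemI)
      show "\<not> p dvd 1"
        using p that by (auto simp: Divisibility.prime_def units)
      fix x y assume xy: "p dvd x * y"
      show "p dvd x \<or> p dvd y"
      proof (cases "x = 0 \<or> y = 0")
        case False
        then have "x * y \<noteq> 0"
          using integral[of x y] by (auto simp: R_simps)
        with False xy p show ?thesis
          by (auto simp: Divisibility.prime_def R_simps divides)
      qed auto
    qed (fact that)
  qed
  show thesis
  proof (cases "a dvd 1")
    case True
    show thesis by (rule that[of a "[]"]) (use True in auto)
  next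
    case False
    then obtain fs where fs: "set fs \<subseteq> carrier (mult_of R)" "factors (mult_of R) fs a"
      using factors_exist[of a] assms(2) by (auto simp: R_simps units)
    show thesis
    proof (rule that[of 1 fs])
      show "\<forall>p\<in>set fs. prime_elem p"
        using fs by (auto simp: factors_def R_simps intro!: prime)
      show "a = 1 * prod_list fs"
        using fs by (simp add: factors_def R_simps prod_list.eq_foldr)
    qed simp
  qed
qed

text \<open>
  A prime factor of \<open>p\<close> divides \<open>q * r\<close>, hence \<open>q\<close> or \<open>r\<close>. It can be cancelled there and goes into
  \<open>x\<close> in the first case and into \<open>y\<close> in the second; only a unit is left of \<open>p\<close> in the end.
\<close>

lemma four_number_prime_product:
  fixes q r s u :: "'r::comm_ring_1"
  assumes no_zero_divisors: "\<And>a b :: 'r. a * b = 0 \<Longrightarrow> a = 0 \<or> b = 0"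
    and "u dvd 1" and "\<forall>p\<in>set ps. prime_elem p" and "u * prod_list ps * s = q * r"
  shows "\<exists>x y w z. u * prod_list ps = x * y \<and> q = x * z \<and> r = w * y \<and> s = w * z"
  using assms(3,4)
proof (induction ps arbitrary: q r)
  case Nil
  obtain v where v: "u * v = 1"
    using assms(2) by (metis dvd_def)
  have "s = (u * v) * s" "q = (u * v) * q"
    by (simp_all add: v)
  moreover have "(u * v) * s = v * (u * s)"
    by (simp add: ac_simps)
  moreover have "v * (u * s) = r * (v * q)"
    using Nil(2) by (simp add: ac_simps)
  ultimately have "s = r * (v * q)" "q = u * (v * q)"
    by (simp_all only: mult.assoc)
  then have "u * prod_list [] = u * 1 \<and> q = u * (v * q) \<and> r = r * 1 \<and> s = r * (v * q)"
    by simp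
  then show ?case by blast
next
  case (Cons p ps)
  have p: "prime_elem p" "p \<noteq> 0"
    using Cons.prems by auto
  have cancel: "a = b" if "p * a = p * b" for a b
    using no_zero_divisors[of p "a - b"] that p by (simp add: right_diff_distrib)
  have split_off: "p * (u * prod_list ps * s) = q * r"
    using Cons.prems by (simp add: algebra_simps)
  then consider q' where "q = p * q'" | r' where "r = p * r'"
    using prime_elem_dvd_multD[OF p(1), of q r] by (metis dvd_def)
  then show ?case
  proof cases
    case 1
    then have "p * (u * prod_list ps * s) = p * (q' * r)"
      using split_off by (simp only: mult.assoc)
    then have "u * prod_list ps * s = q' * r"
      by (rule cancel)
    then obtain x y w z where xyz: "u * prod_list ps = x * y" "q' = x * z" "r = w * y" "s = w * z"
      using Cons.IH[of q' r] Cons.prems(1) unfolding list.set by blast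
    have "u * prod_list (p # ps) = (p * x) * y"
      using xyz(1) by (simp add: ac_simps)
    moreover have "q = (p * x) * z"
      using 1 xyz by (simp add: ac_simps)
    ultimately show ?thesis
      using xyz by blast
  next
    case 2
    then have "p * (u * prod_list ps * s) = p * (q * r')"
      using split_off by (simp only: mult.left_commute)
    then have "u * prod_list ps * s = q * r'"
      by (rule cancel)
    then obtain x y w z where xyz: "u * prod_list ps = x * y" "q = x * z" "r' = w * y" "s = w * z"
      using Cons.IH[of q r'] Cons.prems(1) unfolding list.set by blast
    have "u * prod_list (p # ps) = x * (p * y)"
      using xyz(1) by (simp add: ac_simps)
    moreover have "r = w * (p * y)"
      using 2 xyz by (simp add: ac_simps)
    ultimately show ?thesis
      using xyz by blast
  qed
qed

lemma four_number:
  fixes p q r s :: "'r::comm_ring_1"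
  assumes "factorial_domain (ring_of_type_algebra :: 'r ring)" and "p \<noteq> 0" and "p * s = q * r"
  shows "\<exists>x y w z. p = x * y \<and> q = x * z \<and> r = w * y \<and> s = w * z"
proof -
  have no_zero_divisors: "a = 0 \<or> b = 0" if "a * b = 0" for a b :: 'r
  proof -
    interpret factorial_domain "ring_of_type_algebra :: 'r ring" by fact
    show ?thesis
      using integral[of a b] that by (simp add: ring_of_type_algebra_def)
  qed
  obtain u ps where "u dvd 1" "\<forall>t\<in>set ps. prime_elem t" "p = u * prod_list ps"
    using factorial_domain_prime_factors[OF assms(1,2)] by blast
  with four_number_prime_product[OF no_zero_divisors, of u ps s q r] assms(3)
  show ?thesis by simp
qed

text \<open>
  The rows of the inverse of \<open>g\<close> are \<open>(y, z)\<close> and \<open>(- w, x)\<close>, so the conjugates of the two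
  nilpotent matrix units are \<open>(x, w)\<^sup>T (- w, x)\<close> and \<open>(- z, y)\<^sup>T (y, z)\<close>. The matrix \<open>H\<close>
  below is the conjugate of the diagonal matrix with entries \<open>1\<close> and \<open>- 1\<close>.
\<close>

lemma conjugate_standard_triple:
  fixes x y w z :: "'r::comm_ring_1"
  assumes det: "x * y + w * z = 1"
  defines "H \<equiv> vector [vector [x * y - w * z, 2 * (x * z)],
                        vector [2 * (w * y), w * z - x * y]] :: 'r ^ 2 ^ 2"
    and "E \<equiv> vector [vector [- (x * w), x * x], vector [- (w * w), x * w]] :: 'r ^ 2 ^ 2"
    and "F \<equiv> vector [vector [- (z * y), - (z * z)], vector [y * y, z * y]] :: 'r ^ 2 ^ 2"
  shows "commutator H E = E + E" "commutator H F = - (F + F)" "commutator E F = H"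
proof -
  \<comment> \<open>Whatever the value of \<open>x * y + w * z\<close>, the relations hold up to this factor, as polynomial
      identities.\<close>
  note entries = commutator_def matrix_matrix_mult_def vec_eq_iff forall_2 sum_2
    H_def E_def F_def
  have "commutator H E = (\<chi> i j. (x * y + w * z) * (E + E) $ i $ j)"
    by (simp add: entries algebra_simps)
  moreover have "commutator H F = (\<chi> i j. (x * y + w * z) * (- (F + F)) $ i $ j)"
    by (simp add: entries algebra_simps)
  moreover have "commutator E F = (\<chi> i j. (x * y + w * z) * H $ i $ j)"
    by (simp add: entries algebra_simps)
  ultimately show "commutator H E = E + E" "commutator H F = - (F + F)" "commutator E F = H"
    by (simp_all add: det vec_eq_iff)
qed

theorem proposition2:
  fixes smul :: "'f::field \<Rightarrow> 'r::comm_ring_1 \<Rightarrow> 'r"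
    and H :: "'r ^ 2 ^ 2"
  assumes "CHAR('f) \<noteq> 2"
    and "commutative_algebra smul"
    and "factorial_domain (ring_of_type_algebra :: 'r ring)"
    and "H \<in> sl2"
    and "H ** H = mat 1"
  shows "\<exists>E\<in>sl2. \<exists>F\<in>sl2. sl2_triple (mat_smul smul) commutator sl2 E H F"
proof -
  interpret commutative_algebra smul by fact
  define a b c where "a = H $ 1 $ 1" and "b = H $ 1 $ 2" and "c = H $ 2 $ 1"
  have H: "H = vector [vector [a, b], vector [c, - a]]"
    using assms(4) by (simp add: a_def b_def c_def sl2_iff vec_eq_iff forall_2)
  have square: "a * a + b * c = 1"
    using assms(5)
    by (simp add: H matrix_matrix_mult_def vec_eq_iff forall_2 sum_2 vector_2 mat_def)

  have two: "(2 :: 'f) \<noteq> 0"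
  proof
    assume "(2 :: 'f) = 0"
    then have "CHAR('f) dvd 2"
      by (metis of_nat_eq_0_iff_char_dvd of_nat_numeral)
    then have "CHAR('f) = 1 \<or> CHAR('f) = 2"
      using two_is_prime_nat unfolding prime_nat_iff by blast
    then show False
      using assms(1) by simp
  qed
  define h where "h = smul (1 / 2) (1 :: 'r)"
  have half: "h + h = 1"
    using two by (simp add: h_def flip: scale_left_distrib)
  define p q r s where "p = h * (1 + a)" and "q = h * b" and "r = h * c" and "s = h * (1 - a)"
  have trace: "p + s = 1"
  proof -
    have "p + s = h + h"
      by (simp add: p_def s_def algebra_simps)
    then show ?thesis
      by (simp add: half)
  qed
  have rank: "p * s = q * r"
  proof -
    have "p * s = h * h * (1 - a * a)"
      by (simp add: p_def s_def algebra_simps)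
    also have "1 - a * a = b * c"
      using square by (simp add: algebra_simps)
    finally show ?thesis
      by (simp add: q_def r_def ac_simps)
  qed

  have "p \<noteq> 0 \<or> s \<noteq> 0"
    using trace by auto
  \<comment> \<open>If \<open>p = 0\<close> then \<open>s = 1\<close> can be factored in its place; the problem is symmetric under swapping
      \<open>p\<close> with \<open>s\<close> and \<open>q\<close> with \<open>r\<close>.\<close>
  then obtain x y w z where factors: "p = x * y" "q = x * z" "r = w * y" "s = w * z"
  proof
    assume "p \<noteq> 0"
    from four_number[OF assms(3) this rank] that show thesis by blast
  next
    assume "s \<noteq> 0"
    moreover have "s * p = r * q"
      using rank by (simp add: ac_simps)
    ultimately show thesis
      using four_number[OF assms(3), of s p r q] that by blast
  qed
  have det: "x * y + w * z = 1"
    using trace factors by simp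

  define E where "E = (vector [vector [- (x * w), x * x], vector [- (w * w), x * w]] :: 'r ^ 2 ^ 2)"
  define F where "F = (vector [vector [- (z * y), - (z * z)], vector [y * y, z * y]] :: 'r ^ 2 ^ 2)"
  have "a = x * y - w * z" "b = 2 * (x * z)" "c = 2 * (w * y)"
  proof -
    have "p - s = (h + h) * a" "2 * q = (h + h) * b" "2 * r = (h + h) * c"
      by (simp_all add: p_def q_def r_def s_def algebra_simps)
    then show "a = x * y - w * z" "b = 2 * (x * z)" "c = 2 * (w * y)"
      by (simp_all add: half factors)
  qed
  then have "H = vector [vector [x * y - w * z, 2 * (x * z)], vector [2 * (w * y), w * z - x * y]]"
    by (simp add: H)
  then have brackets: "commutator H E = E + E" "commutator H F = - (F + F)" "commutator E F = H"
    using conjugate_standard_triple[OF det] unfolding E_def F_def by simp_all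

  have "H \<noteq> 0"
    using square by (auto simp: H vec_eq_iff forall_2)
  moreover from this have "E \<noteq> 0" "F \<noteq> 0"
    using brackets(3) by (auto simp: commutator_def)
  moreover have in_sl2: "E \<in> sl2" "F \<in> sl2"
    by (simp_all add: E_def F_def sl2_iff)
  moreover have "smul 2 t = t + t" "smul (- 2) t = - (t + t)" for t
    using scale_left_distrib[of 1 1 t] by simp_all
  then have "mat_smul smul 2 E = E + E" "mat_smul smul (- 2) F = - (F + F)"
    by (simp_all add: mat_smul_def vec_eq_iff)
  ultimately have "sl2_triple (mat_smul smul) commutator sl2 E H F"
    using brackets assms(4) by (simp add: sl2_triple_def)
  with in_sl2 show ?thesis by blast
qed

end
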